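(* Let $\mathbb{K}$ be a field of characteristic zero and let $L = S\oplus_{\pi}\mathcal{R}$ be a finite-dimensional semi-direct sum, where $\pi$ is an irreducible representation of $S=\mathfrak{sl}(2,\mathbb{K})$ in the solvable radical $\mathcal{R}$, and suppose that $\dim\mathcal{R}\geq 4$. Let $x,y,h$ be the standard basis of $S$, let $m=\dim\mathcal{R}-1$, and let $v_0,\dots,v_m$ be the standard weight basis of $\mathcal{R}$; use the same letters for the corresponding coordinates on $L^*$. (a) Every invariant $F$ of $L$ has the form $F=F(v_0,\dots,v_m)$; that is, $F$ does not depend on the variables $x$, $y$ and $h$ associated with $\mathfrak{sl}(2,\mathbb{K})$. (b) The invariants of $L$ are all completely determined by the $[S,\mathcal{R}]$-type commutation relations alone; that is, a function $F$ is an invariant of $L$ if and only if it is of the form $F=F(v_0,\dots,v_m)$ and satisfies $$\sum_{j=0}^m [e,v_j]\,\frac{\partial F}{\partial v_j}=0\qquad\text{for each } e\in\{x,y,h\}.$$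
   Context: Semi-direct sum: $L = S \oplus_{\pi} \mathcal{R}$ means that $L$ is the vector space direct sum of the subalgebra $S$ and the solvable ideal $\mathcal{R}$, with $[s,v]=\pi(s)v$ for $s\in S$, $v\in\mathcal{R}$. Bases: $[h,x]=2x$, $[h,y]=-2y$, $[x,y]=h$, and $h\cdot v_i=(m-2i)v_i$, $y\cdot v_i=(i+1)v_{i+1}$, $x\cdot v_i=(m-i+1)v_{i-1}$, with $v_{-1}=v_{m+1}=0$. Invariants: let $e_1,\dots,e_n$ be a basis of a Lie algebra $L$ with structure constants $c_{ij}^k$ (so $[e_i,e_j]=\sum_k c_{ij}^k e_k$) and let $x_1,\dots,x_n$ be the corresponding coordinates on the dual space $L^*$ ($x_k(f)=f(e_k)$). Write $[x_i,x_j]=\sum_k c_{ij}^k x_k$, a linear function on $L^*$. An invariant of $L$ (an invariant of the coadjoint representation) is a function $F$ of $x_1,\dots,x_n$ satisfying $\sum_{j} [x_i,x_j] \,\partial F/\partial x_j = 0$ for $i=1,\dots,n$. Here functions are analytic functions on nonempty connected open subsets of $L^*$ when $\mathbb{K}=\mathbb{R}$ or $\mathbb{C}$; for general $\mathbb{K}$ they are understood formally, as formal power series over $\mathbb{K}$ around a point of $L^*$. "$F$ does not depend on a variable" (equivalently, is a function of the remaining variables only) means that the partial derivative of $F$ with respect to that variable vanishes identically. *)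

theory Defs
  imports "HOL-Analysis.Analysis" "HOL-Library.Poly_Mapping"
begin

section \<open>Lie algebras\<close>

locale lie_algebra = vector_space scale
  for scale :: "'k::field \<Rightarrow> 'l::ab_group_add \<Rightarrow> 'l" +
  fixes br :: "'l \<Rightarrow> 'l \<Rightarrow> 'l"
  assumes br_add_left: "br (a + b) c = br a c + br b c"
    and br_add_right: "br a (b + c) = br a b + br a c"
    and br_scale_left: "br (scale t a) b = scale t (br a b)"
    and br_scale_right: "br a (scale t b) = scale t (br a b)"
    and br_self: "br a a = 0"
    and jacobi: "br a (br b c) + br b (br c a) + br c (br a b) = 0"
begin

definition subalgebra :: "'l set \<Rightarrow> bool" where
  "subalgebra A \<longleftrightarrow> subspace A \<and> (\<forall>a\<in>A. \<forall>b\<in>A. br a b \<in> A)"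

definition lie_ideal :: "'l set \<Rightarrow> bool" where
  "lie_ideal A \<longleftrightarrow> subspace A \<and> (\<forall>a. \<forall>b\<in>A. br a b \<in> A)"

definition derived :: "'l set \<Rightarrow> 'l set" where
  "derived A = span {br a b |a b. a \<in> A \<and> b \<in> A}"

definition solvable :: "'l set \<Rightarrow> bool" where
  "solvable A \<longleftrightarrow> subalgebra A \<and> (\<exists>n. (derived ^^ n) A = {0})"

definition solvable_radical :: "'l set \<Rightarrow> bool" where
  "solvable_radical R \<longleftrightarrow> lie_ideal R \<and> solvable R \<and> (\<forall>A. lie_ideal A \<and> solvable A \<longrightarrow> A \<subseteq> R)"

definition lie_representation :: "'l set \<Rightarrow> 'l set \<Rightarrow> ('l \<Rightarrow> 'l \<Rightarrow> 'l) \<Rightarrow> bool" where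
  "lie_representation S V \<pi> \<longleftrightarrow>
     subalgebra S \<and> subspace V \<and>
     (\<forall>s\<in>S. \<forall>u\<in>V. \<pi> s u \<in> V) \<and>
     (\<forall>s\<in>S. \<forall>u\<in>V. \<forall>w\<in>V. \<pi> s (u + w) = \<pi> s u + \<pi> s w) \<and>
     (\<forall>s\<in>S. \<forall>c. \<forall>u\<in>V. \<pi> s (scale c u) = scale c (\<pi> s u)) \<and>
     (\<forall>s\<in>S. \<forall>t\<in>S. \<forall>u\<in>V. \<pi> (s + t) u = \<pi> s u + \<pi> t u) \<and>
     (\<forall>c. \<forall>s\<in>S. \<forall>u\<in>V. \<pi> (scale c s) u = scale c (\<pi> s u)) \<and>
     (\<forall>s\<in>S. \<forall>t\<in>S. \<forall>u\<in>V. \<pi> (br s t) u = \<pi> s (\<pi> t u) - \<pi> t (\<pi> s u))"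

definition irreducible_representation :: "'l set \<Rightarrow> 'l set \<Rightarrow> ('l \<Rightarrow> 'l \<Rightarrow> 'l) \<Rightarrow> bool" where
  "irreducible_representation S V \<pi> \<longleftrightarrow>
     lie_representation S V \<pi> \<and> V \<noteq> {0} \<and>
     (\<forall>W. subspace W \<and> W \<subseteq> V \<and> (\<forall>s\<in>S. \<forall>w\<in>W. \<pi> s w \<in> W) \<longrightarrow> W = {0} \<or> W = V)"

definition semidirect_sum :: "'l set \<Rightarrow> 'l set \<Rightarrow> ('l \<Rightarrow> 'l \<Rightarrow> 'l) \<Rightarrow> bool" where
  "semidirect_sum S R \<pi> \<longleftrightarrow>
     subalgebra S \<and> lie_ideal R \<and> solvable R \<and>
     S \<inter> R = {0} \<and> {s + r |s r. s \<in> S \<and> r \<in> R} = UNIV \<and>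
     (\<forall>s\<in>S. \<forall>u\<in>R. br s u = \<pi> s u)"

end


section \<open>The special linear algebra of 2 by 2 matrices\<close>

definition sl2 :: "('k::field ^ 2 ^ 2) set" where
  "sl2 = {A. trace A = 0}"

definition sl2_x :: "'k::field ^ 2 ^ 2" where
  "sl2_x = vector [vector [0, 1], vector [0, 0]]"

definition sl2_y :: "'k::field ^ 2 ^ 2" where
  "sl2_y = vector [vector [0, 0], vector [1, 0]]"

definition sl2_h :: "'k::field ^ 2 ^ 2" where
  "sl2_h = vector [vector [1, 0], vector [0, -1]]"

definition (in lie_algebra) sl2_iso :: "('k ^ 2 ^ 2 \<Rightarrow> 'l) \<Rightarrow> 'l set \<Rightarrow> bool" where
  "sl2_iso \<phi> S \<longleftrightarrow>
     bij_betw \<phi> sl2 S \<and>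
     (\<forall>A\<in>sl2. \<forall>B\<in>sl2. \<phi> (A + B) = \<phi> A + \<phi> B) \<and>
     (\<forall>c. \<forall>A\<in>sl2. \<phi> (\<chi> i j. c * A $ i $ j) = scale c (\<phi> A)) \<and>
     (\<forall>A\<in>sl2. \<forall>B\<in>sl2. \<phi> (A ** B - B ** A) = br (\<phi> A) (\<phi> B))"

text \<open>
  The standard weight basis, with the convention that the vectors with indices
  \<open>-1\<close> and \<open>m + 1\<close> are zero.
\<close>

definition (in lie_algebra) standard_weight_basis ::
    "('l \<Rightarrow> 'l \<Rightarrow> 'l) \<Rightarrow> 'l \<Rightarrow> 'l \<Rightarrow> 'l \<Rightarrow> 'l set \<Rightarrow> nat \<Rightarrow> (nat \<Rightarrow> 'l) \<Rightarrow> bool" where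
  "standard_weight_basis \<pi> x y h V m v \<longleftrightarrow>
     inj_on v {..m} \<and> independent (v ` {..m}) \<and> span (v ` {..m}) = V \<and>
     (\<forall>i\<le>m. \<pi> h (v i) = scale (of_nat m - 2 * of_nat i) (v i)) \<and>
     (\<forall>i\<le>m. \<pi> y (v i) = (if i < m then scale (of_nat (i + 1)) (v (i + 1)) else 0)) \<and>
     (\<forall>i\<le>m. \<pi> x (v i) = (if 0 < i then scale (of_nat (m - i + 1)) (v (i - 1)) else 0))"

locale sl2_semidirect_sum = lie_algebra scale br
  for scale :: "'k::field_char_0 \<Rightarrow> 'l::ab_group_add \<Rightarrow> 'l" and br +
  fixes S R :: "'l set"
    and \<pi> :: "'l \<Rightarrow> 'l \<Rightarrow> 'l"
    and \<phi> :: "'k ^ 2 ^ 2 \<Rightarrow> 'l"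
    and x y h :: 'l
    and m :: nat
    and v :: "nat \<Rightarrow> 'l"
  assumes finite_dim: "\<exists>B. finite B \<and> span B = UNIV"
    and semidirect: "semidirect_sum S R \<pi>"
    and radical: "solvable_radical R"
    and irreducible: "irreducible_representation S R \<pi>"
    and sl2: "sl2_iso \<phi> S"
    and standard_basis: "x = \<phi> sl2_x" "y = \<phi> sl2_y" "h = \<phi> sl2_h"
    and m: "m = dim R - 1"
    and weight_basis: "standard_weight_basis \<pi> x y h R m v"


section \<open>Invariants of the coadjoint representation\<close>

text \<open>
  Throughout, \<open>B\<close> is a finite basis of \<open>L\<close>, and the coordinates on the dual space are
  indexed by the elements of \<open>B\<close> themselves: the coordinate belonging to \<open>b\<close> is
  \<open>f \<mapsto> f b\<close>. Accordingly, multi-indices are finitely supported maps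
  \<open>'l \<Rightarrow>\<^sub>0 nat\<close> whose support lies in \<open>B\<close>.
\<close>

context lie_algebra
begin

definition dual :: "('l \<Rightarrow> 'k) set" where
  "dual = {f. Vector_Spaces.linear scale (*) f}"

definition structure_const :: "'l set \<Rightarrow> 'l \<Rightarrow> 'l \<Rightarrow> 'l \<Rightarrow> 'k" where
  "structure_const B a b c = representation B (br a b) c"

end


subsection \<open>Formal power series around a point of the dual space\<close>

text \<open>
  A formal power series around \<open>p\<close> is given by its coefficients with respect to the
  monomials in the shifted coordinates \<open>t\<^sub>b = x\<^sub>b - p b\<close>, for \<open>b\<close> in \<open>B\<close>.
\<close>

type_synonym ('v, 'k) mseries = "('v \<Rightarrow>\<^sub>0 nat) \<Rightarrow> 'k"

definition mseries_on :: "'v set \<Rightarrow> ('v, 'k::zero) mseries set" where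
  "mseries_on B = {F. \<forall>\<alpha>. F \<alpha> \<noteq> 0 \<longrightarrow> Poly_Mapping.keys \<alpha> \<subseteq> B}"

definition mseries_mult :: "('v, 'k::comm_ring_1) mseries \<Rightarrow> ('v, 'k) mseries \<Rightarrow> ('v, 'k) mseries" where
  "mseries_mult F G = (\<lambda>\<alpha>. \<Sum>(\<beta>, \<gamma>) \<in> {(\<beta>, \<gamma>). \<beta> + \<gamma> = \<alpha>}. F \<beta> * G \<gamma>)"

definition mseries_deriv :: "'v \<Rightarrow> ('v, 'k::comm_ring_1) mseries \<Rightarrow> ('v, 'k) mseries" where
  "mseries_deriv b F =
     (\<lambda>\<alpha>. of_nat (Poly_Mapping.lookup \<alpha> b + 1) * F (\<alpha> + Poly_Mapping.single b 1))"

text \<open>The coordinate function \<open>x\<^sub>b = p b + t\<^sub>b\<close>, expanded around \<open>p\<close>.\<close>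

definition mseries_coord :: "('v \<Rightarrow> 'k::comm_ring_1) \<Rightarrow> 'v \<Rightarrow> ('v, 'k) mseries" where
  "mseries_coord p b =
     (\<lambda>\<alpha>. if \<alpha> = 0 then p b else if \<alpha> = Poly_Mapping.single b 1 then 1 else 0)"

context lie_algebra
begin

definition formal_bracket :: "'l set \<Rightarrow> ('l \<Rightarrow> 'k) \<Rightarrow> 'l \<Rightarrow> 'l \<Rightarrow> ('l, 'k) mseries" where
  "formal_bracket B p a b =
     (\<lambda>\<alpha>. \<Sum>c\<in>B. structure_const B a b c * mseries_coord p c \<alpha>)"

definition formal_invariant :: "'l set \<Rightarrow> ('l \<Rightarrow> 'k) \<Rightarrow> ('l, 'k) mseries \<Rightarrow> bool" where
  "formal_invariant B p F \<longleftrightarrow>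
     (\<forall>a\<in>B. \<forall>\<alpha>. (\<Sum>b\<in>B. mseries_mult (formal_bracket B p a b) (mseries_deriv b F) \<alpha>) = 0)"

end


subsection \<open>Analytic functions on open subsets of the dual space\<close>

text \<open>
  The topology on the dual space is the one induced by the product topology of
  \<^typ>\<open>'l \<Rightarrow> 'k\<close>, that is, pointwise convergence. As a functional on a finite-dimensional
  space is determined linearly by its values on a basis, this is the usual topology of
  the dual space.
\<close>

locale normed_lie_algebra = lie_algebra scale br
  for scale :: "'k::real_normed_field \<Rightarrow> 'l::ab_group_add \<Rightarrow> 'l" and br
begin

definition domain_in_dual :: "('l \<Rightarrow> 'k) set \<Rightarrow> bool" where
  "domain_in_dual U \<longleftrightarrow> openin (top_of_set dual) U \<and> connected U \<and> U \<noteq> {}"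

definition analytic_on_dual :: "'l set \<Rightarrow> (('l \<Rightarrow> 'k) \<Rightarrow> 'k) \<Rightarrow> ('l \<Rightarrow> 'k) set \<Rightarrow> bool" where
  "analytic_on_dual B F U \<longleftrightarrow>
     (\<forall>p\<in>U. \<exists>a r. r > 0 \<and>
        (\<forall>f\<in>U. (\<forall>b\<in>B. norm (f b - p b) < r) \<longrightarrow>
           ((\<lambda>\<alpha>. a \<alpha> * (\<Prod>b\<in>B. (f b - p b) ^ Poly_Mapping.lookup \<alpha> b)) has_sum F f)
             {\<alpha>. Poly_Mapping.keys \<alpha> \<subseteq> B}))"

text \<open>
  Here \<open>\<lambda>w. representation B w b\<close> is the member of the dual basis belonging to \<open>b\<close>.
\<close>

definition partial_deriv :: "'l set \<Rightarrow> 'l \<Rightarrow> (('l \<Rightarrow> 'k) \<Rightarrow> 'k) \<Rightarrow> ('l \<Rightarrow> 'k) \<Rightarrow> 'k" where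
  "partial_deriv B b F f = deriv (\<lambda>t. F (\<lambda>w. f w + t * representation B w b)) 0"

definition bracket_fun :: "'l set \<Rightarrow> 'l \<Rightarrow> 'l \<Rightarrow> ('l \<Rightarrow> 'k) \<Rightarrow> 'k" where
  "bracket_fun B a b f = (\<Sum>c\<in>B. structure_const B a b c * f c)"

definition analytic_invariant :: "'l set \<Rightarrow> ('l \<Rightarrow> 'k) set \<Rightarrow> (('l \<Rightarrow> 'k) \<Rightarrow> 'k) \<Rightarrow> bool" where
  "analytic_invariant B U F \<longleftrightarrow>
     (\<forall>a\<in>B. \<forall>f\<in>U. (\<Sum>b\<in>B. bracket_fun B a b f * partial_deriv B b F f) = 0)"

end

end

theory Submission
  imports Defs
begin

text \<open>
  An irreducible solvable ideal \<open>R\<close> is abelian (\<open>solvable_irreducible_ideal_abelian\<close>). Hence the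
  equation of an invariant that belongs to \<open>v\<^sub>i\<close> involves only the derivatives of \<open>F\<close> in the
  directions \<open>x, y, h\<close>:
  \<open>(m - i + 1) v\<^sub>i\<^sub>-\<^sub>1 F\<^sub>x + (i + 1) v\<^sub>i\<^sub>+\<^sub>1 F\<^sub>y + (m - 2 i) v\<^sub>i F\<^sub>h = 0\<close>.
  For \<open>i = 0, 1, 2\<close> this is a homogeneous system of three equations in three unknowns. If
  \<open>dim R \<ge> 4\<close>, that is \<open>m \<ge> 3\<close>, its determinant is not the zero polynomial
  (\<open>weight_det_poly_nonzero\<close>), and by Cramer's rule its product with each of the three derivatives
  vanishes (\<open>weight_system_cramer\<close>). It remains to cancel the determinant, which yields (a). Given
  that, (b) is immediate: the equations of \<open>x, y, h\<close> lose the terms with derivatives in the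
  directions \<open>x, y, h\<close>, and those of the \<open>v\<^sub>i\<close> become trivial.

  The determinant can be cancelled by looking in the single direction \<open>v\<^sub>1\<close>, in which it is a cubic
  polynomial with the constant leading coefficient \<open>(m - 1) (m - 2)\<close>. For formal power series, a
  counterexample of lowest degree in the variables other than \<open>v\<^sub>1\<close> would restrict to a counterexample over
  the integral domain of power series in one variable (\<open>formal_linear_system_trivial\<close>). For
  analytic functions, the determinant has at most three zeros on each line in direction \<open>v\<^sub>1\<close>; off
  these zeros \<open>F\<close> is locally constant in the directions \<open>x, y, h\<close>, and by continuity it is so at
  the zeros as well (\<open>partial_deriv_zero_by_density\<close>).
\<close>

section \<open>The linear system attached to the first three weight vectors\<close>

text \<open>
  Up to sign, the determinant of the system that the equations belonging to \<open>v\<^sub>0, v\<^sub>1, v\<^sub>2\<close> form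
  for the derivatives in the directions \<open>x, y, h\<close>; here \<open>M\<close> stands for \<open>m\<close> and \<open>a, b, c, d\<close> for the
  coordinates \<open>v\<^sub>0, v\<^sub>1, v\<^sub>2, v\<^sub>3\<close>. It is used over several rings: the ground field, polynomials
  over it, and formal power series over it.
\<close>

definition weight_det :: "'a::comm_ring_1 \<Rightarrow> 'a \<Rightarrow> 'a \<Rightarrow> 'a \<Rightarrow> 'a \<Rightarrow> 'a" where
  "weight_det M a b c d =
     (M - 1) * (M - 2) * b ^ 3 - M * (M - 4) * a * b * c - 2 * M * (M - 1) * a * b * c
     + 3 * M ^ 2 * a ^ 2 * d"

text \<open>
  Each identity in the proof is a row of the adjugate matrix applied to the system, so nothing has
  to be inverted and the conclusion makes sense over any commutative ring.
\<close>

lemma weight_system_cramer: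
  fixes M a b c d X Y H :: "'a::comm_ring_1"
  assumes 0: "- b * Y - M * a * H = 0"
    and 1: "- M * a * X - 2 * c * Y - (M - 2) * b * H = 0"
    and 2: "- (M - 1) * b * X - 3 * d * Y - (M - 4) * c * H = 0"
  shows "weight_det M a b c d * X = 0" "weight_det M a b c d * Y = 0" "weight_det M a b c d * H = 0"
proof -
  define e0 where "e0 = - b * Y - M * a * H"
  define e1 where "e1 = - M * a * X - 2 * c * Y - (M - 2) * b * H"
  define e2 where "e2 = - (M - 1) * b * X - 3 * d * Y - (M - 4) * c * H"
  have z: "e0 = 0" "e1 = 0" "e2 = 0"
    using assms by (simp_all add: e0_def e1_def e2_def)
  have "weight_det M a b c d * X =
      - (2 * (M - 4) * c ^ 2 - 3 * (M - 2) * b * d) * e0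
      - (3 * M * a * d - (M - 4) * b * c) * e1
      - ((M - 2) * b ^ 2 - 2 * M * a * c) * e2"
    unfolding weight_det_def e0_def e1_def e2_def by (simp add: algebra_simps power2_eq_square power3_eq_cube)
  then show "weight_det M a b c d * X = 0" by (simp add: z)
  have "weight_det M a b c d * Y =
      - ((M - 1) * (M - 2) * b ^ 2 - M * (M - 4) * a * c) * e0
      + M * (M - 1) * a * b * e1 - M ^ 2 * a ^ 2 * e2"
    unfolding weight_det_def e0_def e1_def e2_def by (simp add: algebra_simps power2_eq_square power3_eq_cube)
  then show "weight_det M a b c d * Y = 0" by (simp add: z)
  have "weight_det M a b c d * H =
      - (3 * M * a * d - 2 * (M - 1) * b * c) * e0 - (M - 1) * b ^ 2 * e1 + M * a * b * e2"
    unfolding weight_det_def e0_def e1_def e2_def by (simp add: algebra_simps power2_eq_square power3_eq_cube)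
  then show "weight_det M a b c d * H = 0" by (simp add: z)
qed

text \<open>
  The determinant on the line through a point in the \<open>v\<^sub>1\<close>-direction. That direction is chosen
  because the only cubic term in \<open>v\<^sub>1\<close> is \<open>(m - 1) (m - 2) v\<^sub>1\<^sup>3\<close>: whatever the base point, the
  restriction is a nonzero polynomial as soon as \<open>m \<ge> 3\<close>.
\<close>

definition weight_det_poly :: "'k::comm_ring_1 \<Rightarrow> 'k \<Rightarrow> 'k \<Rightarrow> 'k \<Rightarrow> 'k \<Rightarrow> 'k poly" where
  "weight_det_poly M a b c d = weight_det [:M:] [:a:] [:b, 1:] [:c:] [:d:]"

lemma weight_det_poly_nonzero:
  fixes a b c d :: "'k::field_char_0"
  assumes "3 \<le> m"
  shows "weight_det_poly (of_nat m) a b c d \<noteq> 0"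
proof -
  have "coeff (weight_det_poly (of_nat m) a b c d) 3 = (of_nat m - 1) * (of_nat m - 2)"
    by (simp add: weight_det_poly_def weight_det_def numeral_poly eval_nat_numeral coeff_pCons
        algebra_simps one_pCons)
  also have "\<dots> = of_nat ((m - 1) * (m - 2))"
    using assms by (simp add: of_nat_diff)
  also have "\<dots> \<noteq> 0"
    using assms by (simp del: of_nat_mult)
  finally show ?thesis
    by auto
qed

lemma poly_weight_det_poly:
  "poly (weight_det_poly M a b c d) t = weight_det M a (b + t) c (d :: 'k::comm_ring_1)"
  by (simp add: weight_det_poly_def weight_det_def algebra_simps)

lemma finite_weight_det_zeros:
  fixes a b c d :: "'k::field_char_0"
  assumes "3 \<le> m"
  shows "finite {t. weight_det (of_nat m) a (b + t) c d = 0}"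
  using poly_roots_finite[OF weight_det_poly_nonzero[OF assms, of a b c d]]
  by (simp add: poly_weight_det_poly)

lemma weight_det_fps_nonzero:
  fixes a b c d :: "'k::field_char_0"
  assumes "3 \<le> m"
  shows "weight_det (fps_const (of_nat m)) (fps_const a) (fps_const b + fps_X) (fps_const c) (fps_const d) \<noteq> 0"
proof -
  have lin: "fps_of_poly [:b, 1:] = fps_const b + fps_X"
    by (simp add: fps_of_poly_pCons)
  have "fps_of_poly (weight_det_poly (of_nat m) a b c d) =
    weight_det (fps_const (of_nat m)) (fps_const a) (fps_const b + fps_X) (fps_const c) (fps_const d)"
    by (simp add: weight_det_poly_def weight_det_def fps_of_poly_simps lin)
  then show ?thesis
    using weight_det_poly_nonzero[OF assms, of a b c d] by (metis fps_of_poly_eq_iff fps_of_poly_0)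
qed

section \<open>Power series sliced along a coordinate axis\<close>

text \<open>
  The degree of a monomial in all variables except \<open>b\<close>. Sorting monomials by it makes a power
  series in many variables a family of power series in the single variable \<open>b\<close>.
\<close>

definition degree_off :: "'v \<Rightarrow> ('v \<Rightarrow>\<^sub>0 nat) \<Rightarrow> nat" where
  "degree_off b \<alpha> = (\<Sum>k \<in> Poly_Mapping.keys \<alpha> - {b}. Poly_Mapping.lookup \<alpha> k)"

lemma degree_off_superset:
  assumes "finite A" "Poly_Mapping.keys \<alpha> \<subseteq> A"
  shows "degree_off b \<alpha> = (\<Sum>k \<in> A - {b}. Poly_Mapping.lookup \<alpha> k)"
  unfolding degree_off_def using assms
  by (intro sum.mono_neutral_left) (auto simp: in_keys_iff)

lemma degree_off_add: "degree_off b (\<alpha> + \<beta>) = degree_off b \<alpha> + degree_off b \<beta>"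
proof -
  let ?A = "Poly_Mapping.keys \<alpha> \<union> Poly_Mapping.keys \<beta>"
  have "Poly_Mapping.keys (\<alpha> + \<beta>) \<subseteq> ?A" by (rule Poly_Mapping.keys_add)
  then show ?thesis
    by (simp add: degree_off_superset[of ?A] lookup_add sum.distrib)
qed

lemma degree_off_single: "degree_off b (Poly_Mapping.single b n) = 0"
  by (simp add: degree_off_superset[of "{b}"])

lemma degree_off_eq_0_imp_single:
  assumes "degree_off b \<alpha> = 0"
  shows "\<alpha> = Poly_Mapping.single b (Poly_Mapping.lookup \<alpha> b)"
proof (rule poly_mapping_eqI)
  fix k
  show "Poly_Mapping.lookup \<alpha> k = Poly_Mapping.lookup (Poly_Mapping.single b (Poly_Mapping.lookup \<alpha> b)) k"
    using assms by (cases "k = b") (auto simp: degree_off_def lookup_single_not_eq in_keys_iff)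
qed

text \<open>
  The product of two series is a sum over these decompositions. A sum over an infinite set is \<open>0\<close>
  by convention, so finiteness is what gives the product its intended meaning.
\<close>

lemma finite_decompositions:
  fixes \<alpha> :: "'v \<Rightarrow>\<^sub>0 nat"
  shows "finite {(\<beta>, \<gamma>). \<beta> + \<gamma> = \<alpha>}"
proof -
  let ?K = "Poly_Mapping.keys \<alpha>"
  let ?F = "{f. \<forall>k. (k \<in> ?K \<longrightarrow> f k \<in> {..\<Sum>j\<in>?K. Poly_Mapping.lookup \<alpha> j}) \<and> (k \<notin> ?K \<longrightarrow> f k = 0)}"
  have bound: "Poly_Mapping.lookup \<beta> \<in> ?F" if "\<beta> + \<gamma> = \<alpha>" for \<beta> \<gamma>
  proof -
    have le: "Poly_Mapping.lookup \<beta> k \<le> Poly_Mapping.lookup \<alpha> k" for k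
      by (simp add: that[symmetric] lookup_add)
    have "Poly_Mapping.lookup \<alpha> k \<le> (\<Sum>j\<in>?K. Poly_Mapping.lookup \<alpha> j)" if "k \<in> ?K" for k
      using that by (intro member_le_sum) auto
    with le show ?thesis
      by (auto simp: in_keys_iff intro: order_trans) (metis le le_zero_eq)
  qed
  let ?h = "\<lambda>(\<beta>, \<gamma>). (Poly_Mapping.lookup \<beta>, Poly_Mapping.lookup \<gamma>)"
  have "finite (?F \<times> ?F)"
    by (intro finite_cartesian_product finite_set_of_finite_funs) auto
  moreover have "?h ` {(\<beta>, \<gamma>). \<beta> + \<gamma> = \<alpha>} \<subseteq> ?F \<times> ?F"
    using bound by (force simp: add.commute)
  ultimately have "finite (?h ` {(\<beta>, \<gamma>). \<beta> + \<gamma> = \<alpha>})"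
    by (rule finite_subset[rotated])
  moreover have "inj_on ?h {(\<beta>, \<gamma>). \<beta> + \<gamma> = \<alpha>}"
    by (auto simp: inj_on_def lookup_inject)
  ultimately show ?thesis
    by (rule finite_imageD)
qed

text \<open>
  The power series in \<open>b\<close> that multiplies the monomial \<open>\<beta>\<close>, for \<open>\<beta>\<close> free of \<open>b\<close>. In particular,
  \<open>slice b 0 F\<close> is the restriction of \<open>F\<close> to the \<open>b\<close>-axis.
\<close>

definition slice :: "'v \<Rightarrow> ('v \<Rightarrow>\<^sub>0 nat) \<Rightarrow> ('v, 'k) mseries \<Rightarrow> 'k fps" where
  "slice b \<beta> F = Abs_fps (\<lambda>n. F (\<beta> + Poly_Mapping.single b n))"

lemma slice_nth [simp]: "fps_nth (slice b \<beta> F) n = F (\<beta> + Poly_Mapping.single b n)"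
  by (simp add: slice_def)

lemma slice_zero: "slice b \<beta> (\<lambda>_. 0) = 0"
  by (rule fps_ext) simp

lemma slice_scaled: "slice b \<beta> (\<lambda>\<alpha>. (t :: 'k::comm_ring_1) * F \<alpha>) = fps_const t * slice b \<beta> F"
  by (rule fps_ext) simp

lemma axis_coord:
  fixes p :: "'v \<Rightarrow> 'k::comm_ring_1"
  shows "slice b 0 (mseries_coord p c) = fps_const (p c) + (if c = b then fps_X else 0)"
proof (rule fps_ext)
  fix n :: nat
  have z: "Poly_Mapping.single b n = 0 \<longleftrightarrow> n = 0"
    by (metis lookup_single_eq lookup_zero single_zero)
  have s: "Poly_Mapping.single b n = Poly_Mapping.single c 1 \<longleftrightarrow> b = c \<and> n = 1"
    by (metis lookup_single_eq lookup_single_not_eq zero_neq_one)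
  show "fps_nth (slice b 0 (mseries_coord p c)) n
      = fps_nth (fps_const (p c) + (if c = b then fps_X else 0)) n"
    by (simp add: mseries_coord_def z s del: One_nat_def)
qed

text \<open>
  In the product, the monomial \<open>\<beta>\<close> splits between the two factors. Any share of the first factor
  off the \<open>b\<close>-axis leaves the second factor with a degree at which it vanishes, so only the
  restriction of the first factor to the axis contributes.
\<close>

lemma slice_mult:
  fixes G :: "('v, 'k::comm_ring_1) mseries"
  assumes \<beta>: "Poly_Mapping.lookup \<beta> b = 0"
    and low: "\<And>\<gamma>. degree_off b \<gamma> < degree_off b \<beta> \<Longrightarrow> G \<gamma> = 0"
  shows "slice b \<beta> (mseries_mult A G) = slice b 0 A * slice b \<beta> G"
proof (rule fps_ext)
  fix n
  let ?s = "Poly_Mapping.single b :: nat \<Rightarrow> 'v \<Rightarrow>\<^sub>0 nat"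
  let ?P = "{(\<delta>, \<gamma>). \<delta> + \<gamma> = \<beta> + ?s n}"
  let ?h = "\<lambda>i. (?s i, \<beta> + ?s (n - i))"
  have inj: "inj_on ?h {0..n}"
    by (rule inj_onI) (metis lookup_single_eq prod.inject)
  have sub: "?h ` {0..n} \<subseteq> ?P"
    by (auto simp: single_add[symmetric] add.left_commute)
  have zero: "A \<delta> * G \<gamma> = 0" if P: "(\<delta>, \<gamma>) \<in> ?P" and out: "(\<delta>, \<gamma>) \<notin> ?h ` {0..n}" for \<delta> \<gamma>
  proof (cases "degree_off b \<delta> = 0")
    case True
    define i where "i = Poly_Mapping.lookup \<delta> b"
    have \<delta>: "\<delta> = ?s i"
      unfolding i_def by (rule degree_off_eq_0_imp_single[OF True])
    (* Comparing exponents of b shows i \<le> n; without it n - i would be truncated. *)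
    have eq: "?s i + \<gamma> = \<beta> + ?s n"
      using P \<delta> by simp
    then have "i + Poly_Mapping.lookup \<gamma> b = n"
      using \<beta> by (metis add_0 lookup_add lookup_single_eq)
    then have i: "i \<le> n" by simp
    have "?s i + \<gamma> = ?s i + (\<beta> + ?s (n - i))"
      using i eq by (simp add: single_add[symmetric] add.left_commute)
    then have "\<gamma> = \<beta> + ?s (n - i)" by simp
    with \<delta> i out show ?thesis by auto
  next
    case False
    have "degree_off b \<delta> + degree_off b \<gamma> = degree_off b \<beta>"
      using P by (metis (mono_tags, lifting) add.right_neutral case_prodD mem_Collect_eq degree_off_add degree_off_single)
    with False have "G \<gamma> = 0" by (intro low) simp
    then show ?thesis by simp
  qed
  have "mseries_mult A G (\<beta> + ?s n) = (\<Sum>(\<delta>, \<gamma>) \<in> ?h ` {0..n}. A \<delta> * G \<gamma>)"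
    unfolding mseries_mult_def
    by (rule sum.mono_neutral_right[OF finite_decompositions sub]) (use zero in auto)
  also have "\<dots> = (\<Sum>i=0..n. A (?s i) * G (\<beta> + ?s (n - i)))"
    by (simp add: sum.reindex[OF inj])
  finally show "fps_nth (slice b \<beta> (mseries_mult A G)) n = fps_nth (slice b 0 A * slice b \<beta> G) n"
    by (simp add: fps_mult_nth)
qed

lemma mseries_eq_0_if_slices:
  fixes G :: "('v, 'k::comm_ring_1) mseries"
  assumes "\<And>\<beta>. Poly_Mapping.lookup \<beta> b = 0 \<Longrightarrow> degree_off b \<beta> = d \<Longrightarrow> slice b \<beta> G = 0"
    and "degree_off b \<alpha> = d"
  shows "G \<alpha> = 0"
proof -
  define n where "n = Poly_Mapping.lookup \<alpha> b"
  define \<beta> where "\<beta> = \<alpha> - Poly_Mapping.single b n"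
  have \<alpha>: "\<alpha> = \<beta> + Poly_Mapping.single b n"
    by (rule poly_mapping_eqI) (simp add: \<beta>_def n_def lookup_add lookup_minus lookup_single when_def)
  have "Poly_Mapping.lookup \<beta> b = 0"
    by (simp add: \<beta>_def n_def lookup_minus)
  moreover have "degree_off b \<beta> = d"
    using assms(2) by (simp add: \<alpha> degree_off_add degree_off_single)
  ultimately have "fps_nth (slice b \<beta> G) n = 0"
    using assms(1) by simp
  then show ?thesis by (simp add: \<alpha>)
qed

text \<open>
  A homogeneous linear system over power series in many variables has only the zero solution if
  its restriction to one coordinate axis has: in a nonzero solution, the slices of lowest degree
  off the axis would solve the restricted system. The coefficients of the restricted system lie in
  a ring of univariate power series, which over a field is an integral domain.
\<close>

lemma formal_linear_system_trivial:
  fixes A :: "'e \<Rightarrow> 's \<Rightarrow> ('v, 'k::comm_ring_1) mseries" and Z :: "'s \<Rightarrow> ('v, 'k) mseries"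
  assumes eqs: "\<And>e \<alpha>. e \<in> E \<Longrightarrow> (\<Sum>s\<in>I. mseries_mult (A e s) (Z s) \<alpha>) = 0"
    and axis: "\<And>z. (\<And>e. e \<in> E \<Longrightarrow> (\<Sum>s\<in>I. slice b 0 (A e s) * z s) = 0) \<Longrightarrow> \<forall>s\<in>I. z s = 0"
    and "s \<in> I"
  shows "Z s \<alpha> = 0"
  using \<open>s \<in> I\<close>
proof (induction "degree_off b \<alpha>" arbitrary: \<alpha> s rule: less_induct)
  case less
  have "slice b \<beta> (Z s) = 0"
    if \<beta>: "Poly_Mapping.lookup \<beta> b = 0" and d: "degree_off b \<beta> = degree_off b \<alpha>" for \<beta>
  proof -
    have "(\<Sum>s\<in>I. slice b 0 (A e s) * slice b \<beta> (Z s)) = 0" if "e \<in> E" for e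
    proof -
      have "slice b \<beta> (mseries_mult (A e s) (Z s)) = slice b 0 (A e s) * slice b \<beta> (Z s)" if "s \<in> I" for s
        by (rule slice_mult[OF \<beta>]) (use less.hyps d that in auto)
      then have "(\<Sum>s\<in>I. slice b 0 (A e s) * slice b \<beta> (Z s)) = (\<Sum>s\<in>I. slice b \<beta> (mseries_mult (A e s) (Z s)))"
        by simp
      also have "\<dots> = 0"
        by (rule fps_ext) (simp add: fps_sum_nth eqs[OF that])
      finally show ?thesis .
    qed
    from axis[OF this] less.prems show ?thesis by blast
  qed
  then show ?case
    by (rule mseries_eq_0_if_slices) auto
qed

section \<open>The structure of the semi-direct sum\<close>

context lie_algebra
begin

lemma br_zero_right [simp]: "br a 0 = 0"
  using br_scale_right[of a 0 0] by simp

lemma br_span_in_subspace: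
  assumes "subspace W" "a \<in> span A" "\<And>c. c \<in> A \<Longrightarrow> br s c \<in> W"
  shows "br s a \<in> W"
  using assms(2)
proof (induction rule: span_induct_alt)
  case base
  then show ?case using subspace_0[OF assms(1)] by simp
next
  case (step c x y)
  then show ?case
    by (simp add: br_add_right br_scale_right assms subspace_add subspace_scale)
qed

lemma br_skew: "br a b = - br b a"
proof -
  have "br (a + b) (a + b) = br a b + br b a"
    by (simp only: br_add_left br_add_right br_self[of a] br_self[of b] add_0_left add_0_right add.commute)
  then have "br a b + br b a = 0"
    by (simp only: br_self)
  then show ?thesis
    by (simp add: eq_neg_iff_add_eq_0)
qed

lemma br_minus_right: "br a (- b) = - br a b"
  using br_add_right[of a b "-b"] by (simp add: eq_neg_iff_add_eq_0 add.commute)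

text \<open>
  By the Jacobi identity, \<open>[s, [a, b]] = [[s, a], b] + [a, [s, b]]\<close>.
\<close>

lemma ideal_derived_invariant:
  assumes "lie_ideal R" "a \<in> derived R"
  shows "br s a \<in> derived R"
  unfolding derived_def
proof (rule br_span_in_subspace[OF subspace_span assms(2)[unfolded derived_def]])
  fix c assume "c \<in> {br a b |a b. a \<in> R \<and> b \<in> R}"
  then obtain a b where c: "c = br a b" and a: "a \<in> R" and b: "b \<in> R" by auto
  have "br s (br a b) = - br a (br b s) - br b (br s a)"
    using jacobi[of s a b] by (simp add: eq_neg_iff_add_eq_0 algebra_simps)
  also have "br b s = - br s b" by (rule br_skew)
  also have "br b (br s a) = - br (br s a) b" by (rule br_skew)
  finally have eq: "br s c = br a (br s b) + br (br s a) b"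
    by (simp add: c br_minus_right)
  have "br s a \<in> R" "br s b \<in> R"
    using assms(1) a b by (auto simp: lie_ideal_def)
  then have "br a (br s b) \<in> {br a b |a b. a \<in> R \<and> b \<in> R}" "br (br s a) b \<in> {br a b |a b. a \<in> R \<and> b \<in> R}"
    using a b by blast+
  then show "br s c \<in> span {br a b |a b. a \<in> R \<and> b \<in> R}"
    unfolding eq by (intro span_add span_base)
qed

text \<open>
  The derived algebra is a subrepresentation of \<open>R\<close>, hence \<open>0\<close> or \<open>R\<close>; the latter would make the
  derived series of \<open>R\<close> constant, contradicting solvability.
\<close>

lemma solvable_irreducible_ideal_abelian:
  assumes ideal: "lie_ideal R" and solv: "solvable R"
    and irr: "irreducible_representation S R \<pi>"
    and action: "\<forall>s\<in>S. \<forall>u\<in>R. br s u = \<pi> s u"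
    and "a \<in> R" "b \<in> R"
  shows "br a b = 0"
proof -
  have subR: "subspace R" using ideal by (simp add: lie_ideal_def)
  have sub: "derived R \<subseteq> R"
    unfolding derived_def using ideal
    by (intro span_minimal subR) (auto simp: lie_ideal_def)
  have "\<forall>s\<in>S. \<forall>w\<in>derived R. \<pi> s w \<in> derived R"
    using ideal_derived_invariant[OF ideal] sub action by (metis subsetD)
  moreover have "subspace (derived R)"
    by (simp add: derived_def)
  ultimately consider "derived R = {0}" | "derived R = R"
    using irr sub unfolding irreducible_representation_def by blast
  then have "derived R = {0}"
  proof cases
    case 2
    then have "(derived ^^ n) R = R" for n by (induction n) auto
    then have "R = {0}" using solv by (auto simp: solvable_def)
    then show ?thesis using irr by (auto simp: irreducible_representation_def)
  qed
  moreover have "br a b \<in> derived R"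
    unfolding derived_def using assms(5,6) by (intro span_base) auto
  ultimately show ?thesis by simp
qed

text \<open>
  The linear function \<open>[a, b]\<close> on the dual space, evaluated at the point with coordinates \<open>g\<close>.
  Taking for \<open>g\<close> the coefficients of the coordinate functions gives the coefficients of the power
  series \<open>[a, b]\<close>, so that brackets are computed once for formal and analytic invariants.
\<close>

definition bracket_comb :: "'l set \<Rightarrow> ('l \<Rightarrow> 'k) \<Rightarrow> 'l \<Rightarrow> 'l \<Rightarrow> 'k" where
  "bracket_comb B g a b = (\<Sum>c\<in>B. structure_const B a b c * g c)"

lemma bracket_comb_scale:
  assumes "independent B" "finite B" "c \<in> B" "br a b = scale t c"
  shows "bracket_comb B g a b = t * g c"
proof -
  have "bracket_comb B g a b = (\<Sum>c'\<in>B. if c' = c then t * g c' else 0)"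
    unfolding bracket_comb_def structure_const_def assms(4)
    by (intro sum.cong refl)
      (simp add: representation_scale[OF assms(1) span_base[OF assms(3)]] representation_basis[OF assms(1,3)])
  then show ?thesis
    using assms by simp
qed

lemma bracket_comb_0: "br a b = 0 \<Longrightarrow> bracket_comb B g a b = 0"
  by (simp add: bracket_comb_def structure_const_def representation_zero)

end

lemma sl2_basis_in: "sl2_x \<in> sl2" "sl2_y \<in> sl2" "sl2_h \<in> (sl2 :: ('k::field ^ 2 ^ 2) set)"
  by (auto simp: sl2_def sl2_x_def sl2_y_def sl2_h_def trace_def sum_2)

lemma scale_in_sl2:
  assumes "A \<in> sl2"
  shows "(\<chi> i j. c * A $ i $ j) \<in> (sl2 :: ('k::field ^ 2 ^ 2) set)"
  using assms by (simp add: sl2_def trace_def sum_2 distrib_left[symmetric])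

lemma add_in_sl2: "A \<in> sl2 \<Longrightarrow> B \<in> sl2 \<Longrightarrow> A + B \<in> (sl2 :: ('k::field ^ 2 ^ 2) set)"
  by (simp add: sl2_def trace_add)

definition sl2_matrix :: "'k::field \<Rightarrow> 'k \<Rightarrow> 'k \<Rightarrow> 'k ^ 2 ^ 2" where
  "sl2_matrix a b c = vector [vector [c, a], vector [b, - c]]"

lemma sl2_matrix_decomp:
  "sl2_matrix a b c = (\<chi> i j. a * sl2_x $ i $ j) + ((\<chi> i j. b * sl2_y $ i $ j) + (\<chi> i j. c * sl2_h $ i $ j))"
  by (simp add: sl2_matrix_def sl2_x_def sl2_y_def sl2_h_def vec_eq_iff forall_2)

lemma sl2_eq: "A \<in> sl2 \<longleftrightarrow> (\<exists>a b c. A = sl2_matrix a b (c::'k::field))"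
proof
  assume "A \<in> sl2"
  then have "A $ 2 $ 2 = - A $ 1 $ 1"
    by (simp add: sl2_def trace_def sum_2 eq_neg_iff_add_eq_0 add.commute)
  then have "A = sl2_matrix (A $ 1 $ 2) (A $ 2 $ 1) (A $ 1 $ 1)"
    by (simp add: sl2_matrix_def vec_eq_iff forall_2)
  then show "\<exists>a b c. A = sl2_matrix a b c" by blast
qed (auto simp: sl2_def sl2_matrix_def trace_def sum_2)

lemma sl2_matrix_inject: "sl2_matrix a b c = sl2_matrix a' b' c' \<longleftrightarrow> a = a' \<and> b = b' \<and> c = (c'::'k::field)"
  by (auto simp: sl2_matrix_def vec_eq_iff forall_2)

context sl2_semidirect_sum
begin

definition sl2_comb :: "'k \<Rightarrow> 'k \<Rightarrow> 'k \<Rightarrow> 'l" where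
  "sl2_comb a b c = scale a x + (scale b y + scale c h)"

lemma phi_sl2_matrix: "\<phi> (sl2_matrix a b c) = sl2_comb a b c"
proof -
  note s = sl2[unfolded sl2_iso_def]
  have sc: "\<phi> (\<chi> i j. c * A $ i $ j) = scale c (\<phi> A)" if "A \<in> sl2" for c A using s that by blast
  have ad: "\<phi> (A + B) = \<phi> A + \<phi> B" if "A \<in> sl2" "B \<in> sl2" for A B using s that by blast
  show ?thesis
    unfolding sl2_matrix_decomp sl2_comb_def
    by (simp add: ad sc sl2_basis_in scale_in_sl2 add_in_sl2 flip: standard_basis)
qed

lemma bij_phi: "bij_betw \<phi> sl2 S"
  using sl2 unfolding sl2_iso_def by (rule conjunct1)

lemma S_eq: "S = {sl2_comb a b c |a b c. True}"
proof -
  have "S = \<phi> ` sl2"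
    using bij_betw_imp_surj_on[OF bij_phi] by (rule sym)
  also have "sl2 = {sl2_matrix a b c |a b c. True}"
    using sl2_eq by blast
  also have "\<phi> ` \<dots> = {\<phi> (sl2_matrix a b c) |a b c. True}"
    by auto
  finally show ?thesis
    by (simp add: phi_sl2_matrix)
qed

lemma sl2_comb_inject: "sl2_comb a b c = sl2_comb a' b' c' \<longleftrightarrow> a = a' \<and> b = b' \<and> c = c'"
proof -
  have "inj_on \<phi> sl2"
    using bij_phi by (rule bij_betw_imp_inj_on)
  then have "\<phi> (sl2_matrix a b c) = \<phi> (sl2_matrix a' b' c') \<longleftrightarrow> sl2_matrix a b c = sl2_matrix a' b' c'"
    by (rule inj_on_eq_iff) (auto simp: sl2_eq)
  then show ?thesis by (simp add: phi_sl2_matrix sl2_matrix_inject)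
qed

lemma xyh_comb: "x = sl2_comb 1 0 0" "y = sl2_comb 0 1 0" "h = sl2_comb 0 0 1"
  by (simp_all add: sl2_comb_def)

lemma xyh_distinct: "x \<noteq> y" "x \<noteq> h" "y \<noteq> h"
  using sl2_comb_inject[of 1 0 0 0 1 0] sl2_comb_inject[of 1 0 0 0 0 1] sl2_comb_inject[of 0 1 0 0 0 1]
  unfolding xyh_comb[symmetric] by auto

lemma xyh_in_S: "x \<in> S" "y \<in> S" "h \<in> S"
proof -
  have "sl2_comb a b c \<in> S" for a b c
    using S_eq by blast
  from this[of 1 0 0] this[of 0 1 0] this[of 0 0 1] show "x \<in> S" "y \<in> S" "h \<in> S"
    unfolding xyh_comb[symmetric] by auto
qed

lemma sl2_comb_0: "sl2_comb 0 0 0 = 0"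
  by (simp add: sl2_comb_def)

definition basis :: "'l set" where "basis = {x, y, h} \<union> v ` {..m}"

lemma in_basis [simp]: "x \<in> basis" "y \<in> basis" "h \<in> basis" "i \<le> m \<Longrightarrow> v i \<in> basis"
  by (simp_all add: basis_def)

lemma weight_vectors: "inj_on v {..m}" "independent (v ` {..m})" "span (v ` {..m}) = R"
  and action_h: "i \<le> m \<Longrightarrow> \<pi> h (v i) = scale (of_nat m - 2 * of_nat i) (v i)"
  and action_y: "i \<le> m \<Longrightarrow> \<pi> y (v i) = (if i < m then scale (of_nat (i + 1)) (v (i + 1)) else 0)"
  and action_x: "i \<le> m \<Longrightarrow> \<pi> x (v i) = (if 0 < i then scale (of_nat (m - i + 1)) (v (i - 1)) else 0)"
proof -
  note W = weight_basis[unfolded standard_weight_basis_def]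
  show "inj_on v {..m}" by (rule conjunct1[OF W])
  note W = conjunct2[OF W]
  show "independent (v ` {..m})" by (rule conjunct1[OF W])
  note W = conjunct2[OF W]
  show "span (v ` {..m}) = R" by (rule conjunct1[OF W])
  note W = conjunct2[OF W]
  show "i \<le> m \<Longrightarrow> \<pi> h (v i) = scale (of_nat m - 2 * of_nat i) (v i)"
    by (rule conjunct1[OF W, rule_format])
  note W = conjunct2[OF W]
  show "i \<le> m \<Longrightarrow> \<pi> y (v i) = (if i < m then scale (of_nat (i + 1)) (v (i + 1)) else 0)"
    by (rule conjunct1[OF W, rule_format])
  note W = conjunct2[OF W]
  show "i \<le> m \<Longrightarrow> \<pi> x (v i) = (if 0 < i then scale (of_nat (m - i + 1)) (v (i - 1)) else 0)"
    by (rule W[rule_format])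
qed

lemma v_in_R: "i \<le> m \<Longrightarrow> v i \<in> R"
  using span_base[of "v i" "v ` {..m}"] weight_vectors(3) by simp

lemma ideal_R: "lie_ideal R"
  and solvable_R: "solvable R"
  and S_inter_R: "S \<inter> R = {0}"
  and S_plus_R: "{s + r |s r. s \<in> S \<and> r \<in> R} = UNIV"
  and br_S_R: "\<forall>s\<in>S. \<forall>u\<in>R. br s u = \<pi> s u"
proof -
  note D = semidirect[unfolded semidirect_sum_def]
  note D = conjunct2[OF D]
  show "lie_ideal R" by (rule conjunct1[OF D])
  note D = conjunct2[OF D]
  show "solvable R" by (rule conjunct1[OF D])
  note D = conjunct2[OF D]
  show "S \<inter> R = {0}" by (rule conjunct1[OF D])
  note D = conjunct2[OF D]
  show "{s + r |s r. s \<in> S \<and> r \<in> R} = UNIV" by (rule conjunct1[OF D])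
  show "\<forall>s\<in>S. \<forall>u\<in>R. br s u = \<pi> s u" by (rule conjunct2[OF D])
qed

lemma xyh_notin_R: "x \<notin> R" "y \<notin> R" "h \<notin> R"
proof -
  have "x \<noteq> 0" "y \<noteq> 0" "h \<noteq> 0"
    using sl2_comb_inject[of 1 0 0 0 0 0] sl2_comb_inject[of 0 1 0 0 0 0] sl2_comb_inject[of 0 0 1 0 0 0]
    unfolding sl2_comb_0 xyh_comb[symmetric] by auto
  then show "x \<notin> R" "y \<notin> R" "h \<notin> R" using S_inter_R xyh_in_S by blast+
qed

lemma basis_disjoint: "{x, y, h} \<inter> v ` {..m} = {}"
proof -
  have "v ` {..m} \<subseteq> R" using v_in_R by auto
  with xyh_notin_R show ?thesis by auto
qed

lemma finite_basis: "finite basis"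
  by (simp add: basis_def)

lemma span_basis: "span basis = UNIV"
proof -
  have "S \<subseteq> span basis"
  proof
    fix s assume "s \<in> S"
    then obtain a b c where s: "s = scale a x + (scale b y + scale c h)"
      unfolding S_eq sl2_comb_def by blast
    show "s \<in> span basis"
      unfolding s by (intro span_add span_scale span_base in_basis)
  qed
  moreover have "R \<subseteq> span basis"
    unfolding weight_vectors(3)[symmetric] basis_def by (intro span_mono Un_upper2)
  ultimately have "s + r \<in> span basis" if "s \<in> S" "r \<in> R" for s r
    using that by (intro span_add) (auto dest: subsetD)
  then have "{s + r |s r. s \<in> S \<and> r \<in> R} \<subseteq> span basis"
    by blast
  then show ?thesis
    unfolding S_plus_R by (rule top.extremum_uniqueI)
qed

lemma ball_basis: "(\<forall>a\<in>basis. P a) \<longleftrightarrow> (\<forall>a\<in>{x, y, h}. P a) \<and> (\<forall>i\<le>m. P (v i))"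
  by (auto simp: basis_def)

lemma sum_weight_vectors: "(\<Sum>b\<in>v ` {..m}. T b) = (\<Sum>j=0..m. T (v j))"
  using sum.reindex[OF weight_vectors(1), of T] by (simp add: atMost_atLeast0)

lemma sum_basis:
  "(\<Sum>b\<in>basis. T b) = T x + T y + T h + (\<Sum>j=0..m. T (v j))"
proof -
  have "(\<Sum>b\<in>basis. T b) = (\<Sum>b\<in>{x, y, h}. T b) + (\<Sum>b\<in>v ` {..m}. T b)"
    unfolding basis_def by (rule sum.union_disjoint[OF _ _ basis_disjoint]) simp_all
  also have "(\<Sum>b\<in>v ` {..m}. T b) = (\<Sum>j=0..m. T (v j))"
    by (rule sum_weight_vectors)
  also have "(\<Sum>b\<in>{x, y, h}. T b) = T x + T y + T h"
    using xyh_distinct by (simp add: add.assoc)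
  finally show ?thesis .
qed

lemma independent_basis: "independent basis"
proof -
  have "u c = 0" if sum0: "(\<Sum>c\<in>basis. scale (u c) c) = 0" and c: "c \<in> basis" for u c
  proof -
    let ?s = "sl2_comb (u x) (u y) (u h)" and ?r = "\<Sum>j=0..m. scale (u (v j)) (v j)"
    have "?s + ?r = 0"
      using sum0 unfolding sum_basis sl2_comb_def by (simp only: add.assoc)
    then have eq: "?s = - ?r"
      by (simp only: eq_neg_iff_add_eq_0)
    have "- ?r \<in> R"
      unfolding weight_vectors(3)[symmetric] by (intro span_neg span_sum span_scale span_base) simp
    moreover have "?s \<in> S"
      using S_eq by blast
    ultimately have "?s \<in> S \<inter> R"
      unfolding eq by (rule IntI[rotated])
    then have s0: "?s = sl2_comb 0 0 0"
      unfolding S_inter_R sl2_comb_0 by (rule singletonD)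
    then have xyh: "u x = 0" "u y = 0" "u h = 0"
      unfolding sl2_comb_inject by auto
    have "?r = 0"
      using eq s0 unfolding sl2_comb_0 by simp
    then have "(\<Sum>b\<in>v ` {..m}. scale (u b) b) = 0"
      by (simp only: sum_weight_vectors)
    then have "\<forall>b\<in>v ` {..m}. u b = 0"
      using weight_vectors(2) by (auto simp: dependent_finite)
    with xyh c show ?thesis
      unfolding basis_def by blast
  qed
  then show ?thesis
    unfolding dependent_finite[OF finite_basis] by blast
qed

lemma br_v_S: "s \<in> S \<Longrightarrow> i \<le> m \<Longrightarrow> br (v i) s = - \<pi> s (v i)"
  using br_skew[of "v i" s] br_S_R v_in_R[of i] by simp

lemma R_abelian: "a \<in> R \<Longrightarrow> b \<in> R \<Longrightarrow> br a b = 0"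
  by (rule solvable_irreducible_ideal_abelian[OF ideal_R solvable_R irreducible br_S_R])

lemma m_ge_3: "4 \<le> dim R \<Longrightarrow> 3 \<le> m"
  using m by simp

lemma bracket_comb_v_v: "i \<le> m \<Longrightarrow> j \<le> m \<Longrightarrow> bracket_comb basis g (v i) (v j) = 0"
  by (intro bracket_comb_0 R_abelian v_in_R)

lemma bracket_comb_v_sl2:
  assumes i: "i \<le> m"
  shows
    "bracket_comb basis g (v i) x = (if 0 < i then - of_nat (m - i + 1) * g (v (i - 1)) else 0)"
    and
    "bracket_comb basis g (v i) y = (if i < m then - of_nat (i + 1) * g (v (i + 1)) else 0)"
    and
    "bracket_comb basis g (v i) h = - (of_nat m - 2 * of_nat i) * g (v i)"
proof -
  have single: "bracket_comb basis g (v i) s = - t * g (v j)"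
    if "s \<in> S" "j \<le> m" "\<pi> s (v i) = scale t (v j)" for s t j
    using that i by (intro bracket_comb_scale independent_basis finite_basis) (auto simp: br_v_S)
  have null: "bracket_comb basis g (v i) s = 0" if "s \<in> S" "\<pi> s (v i) = 0" for s
    using that i by (intro bracket_comb_0) (simp add: br_v_S)
  note x = action_x[OF i] and y = action_y[OF i] and h = action_h[OF i]
  show "bracket_comb basis g (v i) x = (if 0 < i then - of_nat (m - i + 1) * g (v (i - 1)) else 0)"
    using x i single[OF xyh_in_S(1), of "i - 1" "of_nat (m - i + 1)"] null[OF xyh_in_S(1)] by (cases "0 < i") auto
  show "bracket_comb basis g (v i) y = (if i < m then - of_nat (i + 1) * g (v (i + 1)) else 0)"
    using y i single[OF xyh_in_S(2), of "i + 1" "of_nat (i + 1)"] null[OF xyh_in_S(2)] by (cases "i < m") auto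
  show "bracket_comb basis g (v i) h = - (of_nat m - 2 * of_nat i) * g (v i)"
    by (rule single[OF xyh_in_S(3) i h])
qed

text \<open>
  The coefficients of the equations belonging to \<open>v\<^sub>0, v\<^sub>1, v\<^sub>2\<close>. The hypothesis on \<open>m\<close> is what makes
  \<open>v\<^sub>3\<close> available.
\<close>

lemma weight_rows:
  assumes "3 \<le> m"
  shows "bracket_comb basis g (v 0) x = 0"
    "bracket_comb basis g (v 0) y = - g (v 1)"
    "bracket_comb basis g (v 0) h = - of_nat m * g (v 0)"
    "bracket_comb basis g (v 1) x = - of_nat m * g (v 0)"
    "bracket_comb basis g (v 1) y = - 2 * g (v 2)"
    "bracket_comb basis g (v 1) h = - (of_nat m - 2) * g (v 1)"
    "bracket_comb basis g (v 2) x = - (of_nat m - 1) * g (v 1)"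
    "bracket_comb basis g (v 2) y = - 3 * g (v 3)"
    "bracket_comb basis g (v 2) h = - (of_nat m - 4) * g (v 2)"
  using assms bracket_comb_v_sl2[of 0 g] bracket_comb_v_sl2[of 1 g] bracket_comb_v_sl2[of 2 g]
  by (simp_all add: of_nat_diff eval_nat_numeral)

section \<open>Formal invariants\<close>

lemma formal_bracket_eq:
  "formal_bracket basis p a b = (\<lambda>\<alpha>. bracket_comb basis (\<lambda>c. mseries_coord p c \<alpha>) a b)"
  by (simp add: formal_bracket_def bracket_comb_def)

lemma formal_bracket_v_v:
  "i \<le> m \<Longrightarrow> j \<le> m \<Longrightarrow> formal_bracket basis p (v i) (v j) = (\<lambda>_. 0)"
  by (simp add: formal_bracket_eq bracket_comb_v_v)

lemma mseries_mult_0 [simp]: "mseries_mult (\<lambda>_. 0) G = (\<lambda>_. 0)" "mseries_mult G (\<lambda>_. 0) = (\<lambda>_. 0)"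
  by (simp_all add: mseries_mult_def)

text \<open>
  On the axis through \<open>p\<close> in the \<open>v\<^sub>1\<close>-direction, the coordinates \<open>v\<^sub>0, v\<^sub>2, v\<^sub>3\<close> are constants
  and \<open>v\<^sub>1\<close> is a constant plus the variable; the restricted system has a nonzero determinant.
\<close>

lemma formal_invariant_imp_sl2_derivs_zero:
  assumes dim: "4 \<le> dim R" and inv: "formal_invariant basis p F" and b: "b \<in> {x, y, h}"
  shows "mseries_deriv b F \<alpha> = 0"
proof -
  have m3: "3 \<le> m" using m_ge_3[OF dim] .
  have v: "v 0 \<noteq> v 1" "v 2 \<noteq> v 1" "v 3 \<noteq> v 1"
    using m3 by (auto simp: inj_on_eq_iff[OF weight_vectors(1)])
  let ?c = fps_const and ?M = "fps_const (of_nat m :: 'k)"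
  let ?A = "\<lambda>i s. slice (v 1) 0 (formal_bracket basis p (v i) s)"
  show ?thesis
  proof (rule formal_linear_system_trivial[where I = "{x, y, h}" and E = "{0, 1, 2::nat}" and b = "v 1"
        and A = "\<lambda>i s. formal_bracket basis p (v i) s" and Z = "\<lambda>s. mseries_deriv s F"])
    show "b \<in> {x, y, h}" by fact
  next
    fix i :: nat and \<alpha>
    assume "i \<in> {0, 1, 2}"
    then have i: "i \<le> m" using m3 by auto
    then have "v i \<in> basis" by simp
    then have "(\<Sum>b\<in>basis. mseries_mult (formal_bracket basis p (v i) b) (mseries_deriv b F) \<alpha>) = 0"
      using inv unfolding formal_invariant_def by blast
    then show "(\<Sum>s\<in>{x, y, h}. mseries_mult (formal_bracket basis p (v i) s) (mseries_deriv s F) \<alpha>) = 0"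
      using i xyh_distinct by (simp add: sum_basis formal_bracket_v_v add.assoc)
  next
    fix z :: "'l \<Rightarrow> 'k fps"
    assume eq: "\<And>i. i \<in> {0, 1, 2} \<Longrightarrow> (\<Sum>s\<in>{x, y, h}. ?A i s * z s) = 0"
    have eq': "?A i x * z x + ?A i y * z y + ?A i h * z h = 0" if "i \<in> {0, 1, 2}" for i
      using eq[OF that] xyh_distinct by (simp add: add.assoc)
    have A: "?A i s = slice (v 1) 0 (\<lambda>\<alpha>. bracket_comb basis (\<lambda>c. mseries_coord p c \<alpha>) (v i) s)" for i s
      by (simp add: formal_bracket_eq)
    let ?a = "?c (p (v 0))" and ?b = "?c (p (v 1)) + fps_X" and ?d = "?c (p (v 2))" and ?e = "?c (p (v 3))"
    have n2: "?c (2::'k) = 2" "?c (3::'k) = 3" "?c (4::'k) = 4"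
      by (simp_all add: numeral_fps_const)
    have neg: "slice b 0 (\<lambda>\<alpha>. - G \<alpha>) = - slice b 0 G" for b and G :: "('l, 'k) mseries"
      by (rule fps_ext) simp
    note simps = A weight_rows[OF m3] slice_scaled slice_zero neg axis_coord v
      fps_const_neg[symmetric] fps_const_sub[symmetric]
    have "- ?b * z y - ?M * ?a * z h = 0"
      using eq'[of 0] by (simp only: simps) (simp add: algebra_simps del: fps_const_neg fps_const_sub fps_const_mult fps_const_add)
    moreover have "- ?M * ?a * z x - 2 * ?d * z y - (?M - 2) * ?b * z h = 0"
      using eq'[of 1] by (simp only: simps) (simp add: algebra_simps n2 del: fps_const_neg fps_const_sub fps_const_mult fps_const_add)
    moreover have "- (?M - 1) * ?b * z x - 3 * ?e * z y - (?M - 4) * ?d * z h = 0"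
      using eq'[of 2] by (simp only: simps) (simp add: algebra_simps n2 del: fps_const_neg fps_const_sub fps_const_mult fps_const_add)
    ultimately have "weight_det ?M ?a ?b ?d ?e * z x = 0" "weight_det ?M ?a ?b ?d ?e * z y = 0"
        "weight_det ?M ?a ?b ?d ?e * z h = 0"
      by (rule weight_system_cramer)+
    then show "\<forall>s\<in>{x, y, h}. z s = 0"
      using weight_det_fps_nonzero[OF m3, of "p (v 0)" "p (v 1)" "p (v 2)" "p (v 3)"] by simp
  qed
qed

text \<open>
  The equations belonging to the \<open>v\<^sub>i\<close> hold trivially: their terms carry either a vanishing
  derivative or a bracket inside the abelian ideal \<open>R\<close>.
\<close>

lemma formal_invariant_iff_sl2_equations:
  assumes zero: "\<forall>b\<in>{x, y, h}. \<forall>\<alpha>. mseries_deriv b F \<alpha> = 0"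
  shows "formal_invariant basis p F \<longleftrightarrow>
    (\<forall>e\<in>{x, y, h}. \<forall>\<alpha>. (\<Sum>j=0..m. mseries_mult (formal_bracket basis p e (v j)) (mseries_deriv (v j) F) \<alpha>) = 0)"
proof -
  have "mseries_deriv b F = (\<lambda>_. 0)" if "b \<in> {x, y, h}" for b
    using zero that by blast
  then have "(\<Sum>b\<in>basis. mseries_mult (formal_bracket basis p a b) (mseries_deriv b F) \<alpha>)
      = (\<Sum>j=0..m. mseries_mult (formal_bracket basis p a (v j)) (mseries_deriv (v j) F) \<alpha>)" for a \<alpha>
    unfolding sum_basis by simp
  moreover have "(\<Sum>j=0..m. mseries_mult (formal_bracket basis p (v i) (v j)) (mseries_deriv (v j) F) \<alpha>) = 0"
    if "i \<le> m" for i \<alpha>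
    using that by (simp add: formal_bracket_v_v)
  ultimately show ?thesis
    unfolding formal_invariant_def by (simp add: ball_basis)
qed

lemma formal_invariants_characterization:
  assumes dim: "4 \<le> dim R"
  shows "let B = {x, y, h} \<union> v ` {..m} in
    \<forall>p\<in>dual. \<forall>F\<in>mseries_on B.
      (formal_invariant B p F \<longrightarrow> (\<forall>b\<in>{x, y, h}. \<forall>\<alpha>. mseries_deriv b F \<alpha> = 0)) \<and>
      (formal_invariant B p F \<longleftrightarrow>
        (\<forall>b\<in>{x, y, h}. \<forall>\<alpha>. mseries_deriv b F \<alpha> = 0) \<and>
        (\<forall>e\<in>{x, y, h}. \<forall>\<alpha>.
          (\<Sum>j=0..m. mseries_mult (formal_bracket B p e (v j)) (mseries_deriv (v j) F) \<alpha>) = 0))"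
  unfolding Let_def basis_def[symmetric]
proof (intro ballI)
  fix p and F :: "('l, 'k) mseries"
  show "(formal_invariant basis p F \<longrightarrow> (\<forall>b\<in>{x, y, h}. \<forall>\<alpha>. mseries_deriv b F \<alpha> = 0)) \<and>
      (formal_invariant basis p F \<longleftrightarrow>
        (\<forall>b\<in>{x, y, h}. \<forall>\<alpha>. mseries_deriv b F \<alpha> = 0) \<and>
        (\<forall>e\<in>{x, y, h}. \<forall>\<alpha>.
          (\<Sum>j=0..m. mseries_mult (formal_bracket basis p e (v j)) (mseries_deriv (v j) F) \<alpha>) = 0))"
    using formal_invariant_imp_sl2_derivs_zero[OF dim, of p F] formal_invariant_iff_sl2_equations[of F p] by blast
qed

end

section \<open>Analytic invariants\<close>

locale normed_lie_algebra_basis = normed_lie_algebra scale br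
  for scale :: "'k::{real_normed_field,banach} \<Rightarrow> 'l::ab_group_add \<Rightarrow> 'l" and br +
  fixes B :: "'l set"
  assumes fin: "finite B" and ind: "independent B" and spn: "span B = UNIV"
begin

definition translate :: "'l \<Rightarrow> 'k \<Rightarrow> ('l \<Rightarrow> 'k) \<Rightarrow> 'l \<Rightarrow> 'k" where
  "translate b t f = (\<lambda>w. f w + t * representation B w b)"

lemma translate_at: "b \<in> B \<Longrightarrow> c \<in> B \<Longrightarrow> translate b t f c = f c + (if c = b then t else 0)"
  by (auto simp: translate_def representation_basis[OF ind])

lemma translate_0 [simp]: "translate b 0 f = f"
  by (simp add: translate_def)

lemma translate_translate: "translate b s (translate b t f) = translate b (t + s) f"
  by (simp add: translate_def algebra_simps)

lemma translate_commute: "translate b s (translate c t f) = translate c t (translate b s f)"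
  by (simp add: translate_def algebra_simps)

lemma translate_in_dual: "f \<in> dual \<Longrightarrow> translate b t f \<in> dual"
  unfolding dual_def mem_Collect_eq Vector_Spaces.linear_iff
  by (auto simp: translate_def representation_add[OF ind] representation_scale[OF ind] spn algebra_simps)

lemma translate_neighbourhood:
  assumes U: "domain_in_dual U" and "f \<in> U"
  obtains \<epsilon> where "\<epsilon> > 0"
    "\<And>s t. norm s < \<epsilon> \<Longrightarrow> norm t < \<epsilon> \<Longrightarrow> translate b s (translate c t f) \<in> U"
proof -
  obtain T where T: "open T" "U = dual \<inter> T"
    using U unfolding domain_in_dual_def openin_open by blast
  let ?h = "\<lambda>z. translate b (fst z) (translate c (snd z) f)"
  have "continuous_on UNIV ?h"
    unfolding translate_def by (intro continuous_intros)
  then have "open (?h -` T)"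
    using T(1) by (simp add: open_vimage)
  moreover have "(0, 0) \<in> ?h -` T"
    using \<open>f \<in> U\<close> T by simp
  ultimately obtain P Q where PQ: "open P" "open Q" "(0, 0) \<in> P \<times> Q" "P \<times> Q \<subseteq> ?h -` T"
    by (rule open_prod_elim)
  then have "0 \<in> P" "0 \<in> Q" by auto
  obtain d where d: "d > 0" "ball 0 d \<subseteq> P"
    using PQ(1) \<open>0 \<in> P\<close> by (rule openE)
  obtain e where e: "e > 0" "ball 0 e \<subseteq> Q"
    using PQ(2) \<open>0 \<in> Q\<close> by (rule openE)
  have "translate b s (translate c t f) \<in> U" if "norm s < min d e" "norm t < min d e" for s t
  proof -
    have "(s, t) \<in> P \<times> Q"
      using that d e by (auto simp: subset_iff)
    then have "translate b s (translate c t f) \<in> T" using PQ(4) by auto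
    then show ?thesis
      using \<open>f \<in> U\<close> T by (simp add: translate_in_dual)
  qed
  then show thesis using that[of "min d e"] d e by simp
qed

lemma partial_deriv_eq: "partial_deriv B b F f = deriv (\<lambda>t. F (translate b t f)) 0"
  by (simp add: partial_deriv_def translate_def)

text \<open>
  The expansion around \<open>q\<close> itself, restricted to the line through \<open>q\<close> in direction \<open>b\<close>, keeps only
  the powers of one variable and is an ordinary power series. Analyticity provides such an
  expansion around every point, so this gives the derivative everywhere on a coordinate line.
\<close>

lemma analytic_partial_derivative:
  assumes U: "domain_in_dual U" and F: "analytic_on_dual B F U" and q: "q \<in> U" and b: "b \<in> B"
  shows "((\<lambda>t. F (translate b t q)) has_field_derivative partial_deriv B b F q) (at 0)"
proof -
  obtain \<epsilon> where \<epsilon>: "\<epsilon> > 0" "\<And>s t. norm s < \<epsilon> \<Longrightarrow> norm t < \<epsilon> \<Longrightarrow> translate b s (translate b t q) \<in> U"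
    using translate_neighbourhood[OF U q, of b b] by blast
  obtain a r where r: "r > 0"
    and series: "\<And>f. f \<in> U \<Longrightarrow> (\<forall>c\<in>B. norm (f c - q c) < r) \<Longrightarrow>
      ((\<lambda>\<alpha>. a \<alpha> * (\<Prod>c\<in>B. (f c - q c) ^ Poly_Mapping.lookup \<alpha> c)) has_sum F f) {\<alpha>. Poly_Mapping.keys \<alpha> \<subseteq> B}"
    using F q unfolding analytic_on_dual_def by blast
  define \<rho> where "\<rho> = min \<epsilon> r"
  let ?s = "Poly_Mapping.single b :: nat \<Rightarrow> 'l \<Rightarrow>\<^sub>0 nat"
  let ?a = "\<lambda>n. a (?s n)"
  have sums: "(\<lambda>n. ?a n * t ^ n) sums F (translate b t q)" if t: "norm t < \<rho>" for t
  proof -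
    let ?f = "translate b t q"
    let ?g = "\<lambda>\<alpha>. a \<alpha> * (\<Prod>c\<in>B. (?f c - q c) ^ Poly_Mapping.lookup \<alpha> c)"
    have "?f \<in> U" using \<epsilon>(2)[of 0 t] \<epsilon>(1) t by (simp add: \<rho>_def)
    moreover have diff: "?f c - q c = (if c = b then t else 0)" if "c \<in> B" for c
      using that b by (simp add: translate_at)
    ultimately have "(?g has_sum F ?f) {\<alpha>. Poly_Mapping.keys \<alpha> \<subseteq> B}"
      using t r by (intro series) (auto simp: \<rho>_def)
    also have "?this \<longleftrightarrow> (?g has_sum F ?f) (range ?s)"
    proof (rule has_sum_cong_neutral)
      fix \<alpha> assume "\<alpha> \<in> {\<alpha>. Poly_Mapping.keys \<alpha> \<subseteq> B} - range ?s"
      then have \<alpha>: "Poly_Mapping.keys \<alpha> \<subseteq> B" "\<alpha> \<notin> range ?s" by auto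
      have "degree_off b \<alpha> \<noteq> 0"
        using \<alpha>(2) degree_off_eq_0_imp_single[of b \<alpha>] by (metis rangeI)
      then obtain c where c: "c \<in> Poly_Mapping.keys \<alpha>" "c \<noteq> b"
        unfolding degree_off_def by (metis Diff_iff singletonI sum.neutral)
      then have "(?f c - q c) ^ Poly_Mapping.lookup \<alpha> c = 0"
        using \<alpha>(1) by (subst diff) (auto simp: in_keys_iff)
      then have "(\<Prod>c\<in>B. (?f c - q c) ^ Poly_Mapping.lookup \<alpha> c) = 0"
        using c \<alpha>(1) by (intro prod_zero[OF fin]) auto
      then show "?g \<alpha> = 0" by simp
    next
      fix \<alpha> assume "\<alpha> \<in> range ?s - {\<alpha>. Poly_Mapping.keys \<alpha> \<subseteq> B}"
      then show "?g \<alpha> = 0" using b by (auto split: if_splits)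
    qed simp
    also have "\<dots> \<longleftrightarrow> ((?g \<circ> ?s) has_sum F ?f) UNIV"
      by (rule has_sum_reindex) (metis injI lookup_single_eq)
    also have "?g \<circ> ?s = (\<lambda>n. ?a n * t ^ n)"
    proof
      fix n
      have "(\<Prod>c\<in>B. (?f c - q c) ^ Poly_Mapping.lookup (?s n) c) = (\<Prod>c\<in>B. if c = b then t ^ n else 1)"
        by (intro prod.cong refl) (simp add: diff lookup_single_not_eq)
      also have "\<dots> = t ^ n" using fin b by simp
      finally show "(?g \<circ> ?s) n = ?a n * t ^ n" by simp
    qed
    finally show ?thesis by (rule has_sum_imp_sums)
  qed
  have \<rho>: "\<rho> > 0" using \<epsilon> r by (simp add: \<rho>_def)
  have "((\<lambda>t. suminf (\<lambda>n. ?a n * t ^ n)) has_field_derivative suminf (\<lambda>n. diffs ?a n * 0 ^ n)) (at 0)"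
    by (rule termdiffs_strong'[of \<rho>]) (use sums \<rho> in \<open>auto dest: sums_summable\<close>)
  then have "((\<lambda>t. F (translate b t q)) has_field_derivative suminf (\<lambda>n. diffs ?a n * 0 ^ n)) (at 0)"
    by (rule has_field_derivative_transform_within_open[of _ _ _ "ball 0 \<rho>"])
      (use sums \<rho> in \<open>auto simp: sums_iff\<close>)
  then show ?thesis
    by (simp add: partial_deriv_eq DERIV_imp_deriv)
qed

text \<open>
  The derivative vanishes where \<open>d \<noteq> 0\<close>, and has to be shown to vanish at a zero \<open>q\<close> of \<open>d\<close>. As \<open>d\<close>
  is constant in direction \<open>b\<close>, moving \<open>q\<close> slightly in direction \<open>c\<close> gives a whole segment in
  direction \<open>b\<close> on which \<open>d \<noteq> 0\<close>, hence on which \<open>F\<close> is constant. Continuity of \<open>F\<close> along direction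
  \<open>c\<close> carries the constancy over to the segment through \<open>q\<close>.
\<close>

lemma partial_deriv_zero_by_density:
  assumes U: "domain_in_dual U" and F: "analytic_on_dual B F U" and q: "q \<in> U"
    and b: "b \<in> B" and c: "c \<in> B"
    and generic: "\<And>f. f \<in> U \<Longrightarrow> d f \<noteq> 0 \<Longrightarrow> partial_deriv B b F f = 0"
    and invariant: "\<And>s f. d (translate b s f) = d f"
    and zeros: "finite {t. d (translate c t q) = (0 :: 'k)}"
  shows "partial_deriv B b F q = 0"
proof -
  obtain \<epsilon> where \<epsilon>: "\<epsilon> > 0" "\<And>s t. norm s < \<epsilon> \<Longrightarrow> norm t < \<epsilon> \<Longrightarrow> translate b s (translate c t q) \<in> U"
    using translate_neighbourhood[OF U q, of b c] by blast
  have const: "F (translate b s (translate c t q)) = F (translate c t q)"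
    if s: "norm s < \<epsilon>" and t: "norm t < \<epsilon>" and ne: "d (translate c t q) \<noteq> 0" for s t
  proof -
    let ?G = "\<lambda>s. F (translate b s (translate c t q))"
    have "(?G has_field_derivative 0) (at z within ball 0 \<epsilon>)" if "z \<in> ball 0 \<epsilon>" for z
    proof -
      let ?f = "translate b z (translate c t q)"
      have "?f \<in> U" using \<epsilon>(2) that t by simp
      have "partial_deriv B b F ?f = 0"
        using generic[OF \<open>?f \<in> U\<close>] ne unfolding invariant by blast
      then have "((\<lambda>s. F (translate b s ?f)) has_field_derivative 0) (at 0)"
        using analytic_partial_derivative[OF U F \<open>?f \<in> U\<close> b] by simp
      then have "((\<lambda>s. ?G (s + z)) has_field_derivative 0) (at 0)"
        by (simp add: translate_translate add.commute)
      then have "(?G has_field_derivative 0) (at z)"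
        using DERIV_shift[of ?G 0 0 z] by simp
      then show ?thesis by (rule has_field_derivative_at_within)
    qed
    then have "\<exists>k. \<forall>z\<in>ball 0 \<epsilon>. ?G z = k"
      by (rule has_field_derivative_zero_constant[OF convex_ball])
    then have "?G s = ?G 0"
      using s \<epsilon>(1) by (metis dist_0_norm mem_ball centre_in_ball)
    then show ?thesis by simp
  qed
  have "F (translate b s q) = F q" if s: "norm s < \<epsilon>" for s
  proof -
    have lim: "((\<lambda>t. F (translate c t f)) \<longlongrightarrow> F f) (at 0)" if "f \<in> U" for f
      using DERIV_isCont[OF analytic_partial_derivative[OF U F that c]] by (simp add: isCont_def)
    have "translate b s q \<in> U" using \<epsilon>(2)[of s 0] \<epsilon>(1) s by simp
    (* Limits at 0 ignore the parameter 0 itself, where d may vanish. *)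
    from lim[OF this] have 1: "((\<lambda>t. F (translate b s (translate c t q))) \<longlongrightarrow> F (translate b s q)) (at 0)"
      by (simp add: translate_commute[of b])
    have "eventually (\<lambda>t. t \<notin> {t. d (translate c t q) = 0}) (at (0::'k))"
      using islimpt_finite[OF zeros, of 0] by (simp add: islimpt_iff_eventually)
    moreover have "eventually (\<lambda>t. t \<in> ball 0 \<epsilon>) (at (0::'k))"
      by (rule eventually_at_in_open') (use \<epsilon> in auto)
    ultimately have ev: "eventually (\<lambda>t. F (translate b s (translate c t q)) = F (translate c t q)) (at 0)"
      by eventually_elim (rule const[OF s], simp_all)
    have "((\<lambda>t. F (translate b s (translate c t q))) \<longlongrightarrow> F q) (at 0)"
      unfolding tendsto_cong[OF ev] by (rule lim[OF q])
    with 1 show ?thesis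
      by (rule tendsto_unique[rotated]) simp
  qed
  then have eq: "F q = F (translate b s q)" if "s \<in> ball 0 \<epsilon>" for s
    using that by simp
  have "0 \<in> ball (0 :: 'k) \<epsilon>"
    using \<epsilon>(1) by simp
  from has_field_derivative_transform_within_open[OF DERIV_const open_ball this eq]
  have "((\<lambda>s. F (translate b s q)) has_field_derivative 0) (at 0)" .
  then show ?thesis by (simp add: partial_deriv_eq DERIV_imp_deriv)
qed

end

locale analytic_sl2_sum = sl2_semidirect_sum scale br S R \<pi> \<phi> x y h m v + normed_lie_algebra scale br
  for scale :: "'k::{real_normed_field,banach} \<Rightarrow> 'l::ab_group_add \<Rightarrow> 'l" and br S R \<pi> \<phi> x y h m v
begin

sublocale normed_lie_algebra_basis scale br basis
  by unfold_locales (use finite_basis independent_basis span_basis in auto)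

lemma bracket_fun_eq: "bracket_fun basis a b f = bracket_comb basis f a b"
  by (simp add: bracket_fun_def bracket_comb_def)

text \<open>
  Where the determinant is nonzero, the system forces the derivatives to vanish. The determinant
  involves only coordinates of \<open>R\<close>, so it is constant in the directions \<open>x, y, h\<close>, and it has at
  most three zeros on each line in direction \<open>v\<^sub>1\<close>.
\<close>

lemma analytic_invariant_imp_sl2_derivs_zero:
  assumes dim: "4 \<le> dim R" and U: "domain_in_dual U" and F: "analytic_on_dual basis F U"
    and inv: "analytic_invariant basis U F" and b: "b \<in> {x, y, h}" and q: "q \<in> U"
  shows "partial_deriv basis b F q = 0"
proof -
  have m3: "3 \<le> m" using m_ge_3[OF dim] .
  have v: "v 0 \<noteq> v 1" "v 2 \<noteq> v 1" "v 3 \<noteq> v 1"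
    using m3 by (auto simp: inj_on_eq_iff[OF weight_vectors(1)])
  have vB: "v 0 \<in> basis" "v 1 \<in> basis" "v 2 \<in> basis" "v 3 \<in> basis" using m3 by auto
  let ?D = "\<lambda>f. weight_det (of_nat m) (f (v 0)) (f (v 1)) (f (v 2)) (f (v 3))"
  show ?thesis
  proof (rule partial_deriv_zero_by_density[OF U F q, of b "v 1" ?D])
    show "b \<in> basis" "v 1 \<in> basis" using b vB by auto
    have "b \<notin> R" using b xyh_notin_R by auto
    then have "v i \<noteq> b" if "i \<le> m" for i using v_in_R[OF that] by auto
    then show "?D (translate b s f) = ?D f" for s f
      using m3 vB \<open>b \<in> basis\<close> by (simp add: translate_at)
    show "finite {t. ?D (translate (v 1) t q) = 0}"
      using finite_weight_det_zeros[OF m3] v vB by (simp add: translate_at)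
  next
    fix f assume f: "f \<in> U" and ne: "?D f \<noteq> 0"
    let ?P = "\<lambda>c. partial_deriv basis c F f"
    have eq: "bracket_comb basis f (v i) x * ?P x + bracket_comb basis f (v i) y * ?P y
        + bracket_comb basis f (v i) h * ?P h = 0" if "i \<le> m" for i
    proof -
      have "(\<Sum>c\<in>basis. bracket_comb basis f (v i) c * ?P c) = 0"
        using inv f that unfolding analytic_invariant_def bracket_fun_eq by auto
      then show ?thesis using that by (simp add: sum_basis bracket_comb_v_v)
    qed
    note rows = weight_rows[OF m3]
    have "- f (v 1) * ?P y - of_nat m * f (v 0) * ?P h = 0"
      using eq[of 0] by (simp add: rows algebra_simps)
    moreover have "- of_nat m * f (v 0) * ?P x - 2 * f (v 2) * ?P y - (of_nat m - 2) * f (v 1) * ?P h = 0"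
      using eq[of 1] m3 by (simp add: rows[unfolded One_nat_def] algebra_simps)
    moreover have "- (of_nat m - 1) * f (v 1) * ?P x - 3 * f (v 3) * ?P y - (of_nat m - 4) * f (v 2) * ?P h = 0"
      using eq[of 2] m3 by (simp add: rows algebra_simps)
    ultimately have "?D f * ?P x = 0" "?D f * ?P y = 0" "?D f * ?P h = 0"
      by (rule weight_system_cramer)+
    with ne b show "?P b = 0" by auto
  qed
qed

lemma analytic_invariant_iff_sl2_equations:
  assumes zero: "\<forall>b\<in>{x, y, h}. \<forall>f\<in>U. partial_deriv basis b F f = 0"
  shows "analytic_invariant basis U F \<longleftrightarrow>
    (\<forall>e\<in>{x, y, h}. \<forall>f\<in>U. (\<Sum>j=0..m. bracket_fun basis e (v j) f * partial_deriv basis (v j) F f) = 0)"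
proof -
  have "(\<Sum>b\<in>basis. bracket_fun basis a b f * partial_deriv basis b F f)
      = (\<Sum>j=0..m. bracket_fun basis a (v j) f * partial_deriv basis (v j) F f)" if "f \<in> U" for a f
    using zero that by (simp add: sum_basis)
  moreover have "(\<Sum>j=0..m. bracket_fun basis (v i) (v j) f * partial_deriv basis (v j) F f) = 0"
    if "i \<le> m" for i f
    using that by (simp add: bracket_fun_eq bracket_comb_v_v)
  ultimately show ?thesis
    unfolding analytic_invariant_def by (simp add: ball_basis)
qed

lemma analytic_invariants_characterization:
  assumes dim: "4 \<le> dim R"
  shows "let B = {x, y, h} \<union> v ` {..m} in
    \<forall>U F. domain_in_dual U \<and> analytic_on_dual B F U \<longrightarrow>
      (analytic_invariant B U F \<longrightarrow> (\<forall>b\<in>{x, y, h}. \<forall>f\<in>U. partial_deriv B b F f = 0)) \<and>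
      (analytic_invariant B U F \<longleftrightarrow>
        (\<forall>b\<in>{x, y, h}. \<forall>f\<in>U. partial_deriv B b F f = 0) \<and>
        (\<forall>e\<in>{x, y, h}. \<forall>f\<in>U.
          (\<Sum>j=0..m. bracket_fun B e (v j) f * partial_deriv B (v j) F f) = 0))"
  unfolding Let_def basis_def[symmetric]
proof (intro allI impI)
  fix U F
  assume UF: "domain_in_dual U \<and> analytic_on_dual basis F U"
  have "partial_deriv basis b F f = 0" if "analytic_invariant basis U F" "b \<in> {x, y, h}" "f \<in> U" for b f
    by (rule analytic_invariant_imp_sl2_derivs_zero[OF dim conjunct1[OF UF] conjunct2[OF UF] that])
  with analytic_invariant_iff_sl2_equations[of U F]
  show "(analytic_invariant basis U F \<longrightarrow> (\<forall>b\<in>{x, y, h}. \<forall>f\<in>U. partial_deriv basis b F f = 0)) \<and>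
      (analytic_invariant basis U F \<longleftrightarrow>
        (\<forall>b\<in>{x, y, h}. \<forall>f\<in>U. partial_deriv basis b F f = 0) \<and>
        (\<forall>e\<in>{x, y, h}. \<forall>f\<in>U.
          (\<Sum>j=0..m. bracket_fun basis e (v j) f * partial_deriv basis (v j) F f) = 0))"
    by blast
qed

end

lemma analytic_sl2_sumI:
  fixes scale :: "'k::{real_normed_field,banach} \<Rightarrow> 'l::ab_group_add \<Rightarrow> 'l"
  assumes "sl2_semidirect_sum scale br S R \<pi> \<phi> x y h m v"
  shows "analytic_sl2_sum scale br S R \<pi> \<phi> x y h m v"
  using assms by (auto simp: analytic_sl2_sum_def normed_lie_algebra_def sl2_semidirect_sum_def)

theorem theorem5:
  shows
    "(\<forall>(scale :: 'k::field_char_0 \<Rightarrow> 'l::ab_group_add \<Rightarrow> 'l) br S R \<pi> \<phi> x y h m v.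
        sl2_semidirect_sum scale br S R \<pi> \<phi> x y h m v \<and> 4 \<le> vector_space.dim scale R \<longrightarrow>
        (let B = {x, y, h} \<union> v ` {..m} in
          \<forall>p \<in> lie_algebra.dual scale. \<forall>F \<in> mseries_on B.
            (lie_algebra.formal_invariant scale br B p F \<longrightarrow>
               (\<forall>b\<in>{x, y, h}. \<forall>\<alpha>. mseries_deriv b F \<alpha> = 0)) \<and>
            (lie_algebra.formal_invariant scale br B p F \<longleftrightarrow>
               (\<forall>b\<in>{x, y, h}. \<forall>\<alpha>. mseries_deriv b F \<alpha> = 0) \<and>
               (\<forall>e\<in>{x, y, h}. \<forall>\<alpha>.
                  (\<Sum>j=0..m. mseries_mult (lie_algebra.formal_bracket scale br B p e (v j))
                             (mseries_deriv (v j) F) \<alpha>) = 0))))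
     \<and>
     (\<forall>(scale :: real \<Rightarrow> 'l \<Rightarrow> 'l) br S R \<pi> \<phi> x y h m v.
        sl2_semidirect_sum scale br S R \<pi> \<phi> x y h m v \<and> 4 \<le> vector_space.dim scale R \<longrightarrow>
        (let B = {x, y, h} \<union> v ` {..m} in
          \<forall>U F. normed_lie_algebra.domain_in_dual scale U \<and>
                normed_lie_algebra.analytic_on_dual B F U \<longrightarrow>
            (normed_lie_algebra.analytic_invariant scale br B U F \<longrightarrow>
               (\<forall>b\<in>{x, y, h}. \<forall>f\<in>U. normed_lie_algebra.partial_deriv scale B b F f = 0)) \<and>
            (normed_lie_algebra.analytic_invariant scale br B U F \<longleftrightarrow>
               (\<forall>b\<in>{x, y, h}. \<forall>f\<in>U. normed_lie_algebra.partial_deriv scale B b F f = 0) \<and>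
               (\<forall>e\<in>{x, y, h}. \<forall>f\<in>U.
                  (\<Sum>j=0..m. normed_lie_algebra.bracket_fun scale br B e (v j) f *
                             normed_lie_algebra.partial_deriv scale B (v j) F f) = 0))))
     \<and>
     (\<forall>(scale :: complex \<Rightarrow> 'l \<Rightarrow> 'l) br S R \<pi> \<phi> x y h m v.
        sl2_semidirect_sum scale br S R \<pi> \<phi> x y h m v \<and> 4 \<le> vector_space.dim scale R \<longrightarrow>
        (let B = {x, y, h} \<union> v ` {..m} in
          \<forall>U F. normed_lie_algebra.domain_in_dual scale U \<and>
                normed_lie_algebra.analytic_on_dual B F U \<longrightarrow>
            (normed_lie_algebra.analytic_invariant scale br B U F \<longrightarrow>
               (\<forall>b\<in>{x, y, h}. \<forall>f\<in>U. normed_lie_algebra.partial_deriv scale B b F f = 0)) \<and>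
            (normed_lie_algebra.analytic_invariant scale br B U F \<longleftrightarrow>
               (\<forall>b\<in>{x, y, h}. \<forall>f\<in>U. normed_lie_algebra.partial_deriv scale B b F f = 0) \<and>
               (\<forall>e\<in>{x, y, h}. \<forall>f\<in>U.
                  (\<Sum>j=0..m. normed_lie_algebra.bracket_fun scale br B e (v j) f *
                             normed_lie_algebra.partial_deriv scale B (v j) F f) = 0))))"
  by (intro conjI allI impI; elim conjE)
    (erule (1) sl2_semidirect_sum.formal_invariants_characterization
      analytic_sl2_sum.analytic_invariants_characterization[OF analytic_sl2_sumI])+

end
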